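(* Let $\mathcal{X}$ be a Polish space and $G$ a locally compact, $\sigma$-compact, Hausdorff, unimodular topological group with Haar measure $\lambda$, acting on $\mathcal{X}$ by a jointly measurable action $\varphi$. Let $k:\mathcal{X}\times\mathcal{X}\to\mathbb{R}$ be a positive definite kernel and $\rho:\mathcal{X}\to(0,\infty)$ a strictly positive function. Assume that $k$ and $\rho$ are continuous and bounded, and that the Haar measure $\lambda$ belongs to $\mathcal{M}^\rho(G)$. Let $P,Q$ be Borel probability measures on $\mathcal{X}$. Then $S_\lambda P = S_\lambda Q$ if and only if $\Pi_* P = \Pi_* Q$.
   Context: Standing setting. $G$ is a topological group that is locally compact, Hausdorff, $\sigma$-compact and unimodular; $\lambda$ denotes its Haar measure, a nonzero Borel measure invariant under left and right translations (unique up to a multiplicative constant, $\sigma$-finite, possibly of infinite total mass). $\mathcal{X}$ is a Polish space with Borel $\sigma$-algebra $\mathcal{B}(\mathcal{X})$. A (left) action of $G$ on $\mathcal{X}$ is a map $\varphi:G\times\mathcal{X}\to\mathcal{X}$, $(g,x)\mapsto\varphi_g(x)$, with $\varphi_e=\mathrm{id}_{\mathcal{X}}$ and $\varphi_{gh}=\varphi_g\circ\varphi_h$ for all $g,h\in G$; it is assumed jointly measurable with respect to the product $\sigma$-algebra on $G\times\mathcal{X}$. Quotient. The orbit of $x$ is $[x]=\{\varphi_g(x): g\in G\}$, $\mathcal{X}/G$ is the set of orbits, and $\Pi:\mathcal{X}\to\mathcal{X}/G$, $\Pi(x)=[x]$. $\mathcal{X}/G$ carries the quotient $\sigma$-algebra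 $\mathcal{B}(\mathcal{X}/G)=\{A\subseteq\mathcal{X}/G : \Pi^{-1}(A)\in\mathcal{B}(\mathcal{X})\}$. $\Pi_*P$ is the pushforward of $P$ by $\Pi$, a probability measure on $(\mathcal{X}/G,\mathcal{B}(\mathcal{X}/G))$. Positive definite kernel: a symmetric function $k$ with $\sum_{i,j}a_ia_jk(x_i,x_j)\ge 0$ for all finite families of points $x_i$ and reals $a_i$. Admissible measures on $G$. $\mathcal{M}^\rho(G)$ is the set of $\sigma$-finite (nonnegative) Borel measures $\nu$ on $G$ such that $\sup_{x\in\mathcal{X}}\int_G\rho(\varphi_g(x))\,\mathrm{d}\nu(g)<\infty$. Averaged measure. For $\nu\in\mathcal{M}^\rho(G)$ and a Borel probability measure $P$ on $\mathcal{X}$, $S_\nu P=\int_G(\varphi_g)_*P\,\mathrm{d}\nu(g)$, i.e. $S_\nu P(A)=\int_G P(\varphi_g^{-1}(A))\,\mathrm{d}\nu(g)\in[0,\infty]$ for $A\in\mathcal{B}(\mathcal{X})$. *)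

theory Defs
  imports "HOL-Probability.Probability"
begin

text \<open>
  Topological groups are the types of class \<^class>\<open>topological_group_add\<close>, written additively
  but not assumed to be commutative: \<open>g + h\<close> is the product \<open>gh\<close> and \<open>0\<close> the identity.
\<close>

definition sigma_compact_space :: "'a topology \<Rightarrow> bool" where
  "sigma_compact_space X \<longleftrightarrow>
     (\<exists>K :: nat \<Rightarrow> 'a set. (\<forall>n. compactin X (K n)) \<and> (\<Union>n. K n) = topspace X)"

definition left_invariant :: "'g::topological_group_add measure \<Rightarrow> bool" where
  "left_invariant \<mu> \<longleftrightarrow> (\<forall>g. distr \<mu> borel (\<lambda>h. g + h) = \<mu>)"

definition right_invariant :: "'g::topological_group_add measure \<Rightarrow> bool" where
  "right_invariant \<mu> \<longleftrightarrow> (\<forall>g. distr \<mu> borel (\<lambda>h. h + g) = \<mu>)"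

definition radon_measure :: "'a::topological_space measure \<Rightarrow> bool" where
  "radon_measure \<mu> \<longleftrightarrow>
     sets \<mu> = sets borel \<and>
     (\<forall>K. compact K \<longrightarrow> emeasure \<mu> K < \<infinity>) \<and>
     (\<forall>A\<in>sets borel. emeasure \<mu> A = (INF U\<in>{U. open U \<and> A \<subseteq> U}. emeasure \<mu> U)) \<and>
     (\<forall>U. open U \<longrightarrow> emeasure \<mu> U = (SUP K\<in>{K. compact K \<and> K \<subseteq> U}. emeasure \<mu> K))"

text \<open>
  Regularity is part of the notion of a (left) Haar measure: it is what makes the measure unique
  up to a constant when the group is not second countable.
\<close>

definition haar_measure :: "'g::topological_group_add measure \<Rightarrow> bool" where
  "haar_measure \<mu> \<longleftrightarrow> radon_measure \<mu> \<and> left_invariant \<mu> \<and> emeasure \<mu> UNIV \<noteq> 0"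

definition unimodular :: "'g::topological_group_add itself \<Rightarrow> bool" where
  "unimodular (_ :: 'g itself) \<longleftrightarrow>
     (\<forall>\<mu> :: 'g measure. haar_measure \<mu> \<longrightarrow> right_invariant \<mu>)"

definition measurable_action ::
    "('g::topological_group_add \<Rightarrow> 'x::topological_space \<Rightarrow> 'x) \<Rightarrow> bool" where
  "measurable_action \<phi> \<longleftrightarrow>
     \<phi> 0 = id \<and>
     (\<forall>g h. \<phi> (g + h) = \<phi> g \<circ> \<phi> h) \<and>
     (\<lambda>(g, x). \<phi> g x) \<in> measurable (borel \<Otimes>\<^sub>M borel) borel"

definition group_orbit :: "('g \<Rightarrow> 'x \<Rightarrow> 'x) \<Rightarrow> 'x \<Rightarrow> 'x set" where
  "group_orbit \<phi> x = {\<phi> g x |g. True}"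

definition orbit_space :: "('g \<Rightarrow> 'x \<Rightarrow> 'x) \<Rightarrow> 'x set set" where
  "orbit_space \<phi> = range (group_orbit \<phi>)"

text \<open>
  The quotient \<open>\<sigma>\<close>-algebra, as a measure space (with the null measure) to push forward to.
\<close>

definition quotient_borel :: "('g \<Rightarrow> 'x::topological_space \<Rightarrow> 'x) \<Rightarrow> 'x set measure" where
  "quotient_borel \<phi> =
     sigma (orbit_space \<phi>) {A. A \<subseteq> orbit_space \<phi> \<and> group_orbit \<phi> -` A \<in> sets borel}"

lemma space_quotient_borel: "space (quotient_borel \<phi>) = orbit_space \<phi>"
  unfolding quotient_borel_def by (rule space_measure_of) auto

lemma sets_quotient_borel:
  fixes \<phi> :: "'g \<Rightarrow> 'x::topological_space \<Rightarrow> 'x"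
  shows "sets (quotient_borel \<phi>) =
    {A. A \<subseteq> orbit_space \<phi> \<and> group_orbit \<phi> -` A \<in> sets borel}"
proof -
  let ?S = "{A. A \<subseteq> orbit_space \<phi> \<and> group_orbit \<phi> -` A \<in> sets borel}"
  have "sigma_algebra (orbit_space \<phi>) ?S"
  proof (rule sigma_algebra_iff2[THEN iffD2], intro conjI ballI allI impI)
    fix A assume A: "A \<in> ?S"
    have "group_orbit \<phi> -` (orbit_space \<phi> - A) = UNIV - group_orbit \<phi> -` A"
      by (auto simp: orbit_space_def)
    also have "\<dots> \<in> sets borel" using A by auto
    finally show "orbit_space \<phi> - A \<in> ?S" by auto
  qed (auto simp: vimage_UN)
  then have "sigma_sets (orbit_space \<phi>) ?S = ?S"
    by (rule sigma_algebra.sigma_sets_eq)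
  moreover have "?S \<subseteq> Pow (orbit_space \<phi>)" by blast
  ultimately show ?thesis
    unfolding quotient_borel_def by (simp only: sets_measure_of)
qed

definition quotient_pushforward ::
    "('g \<Rightarrow> 'x::topological_space \<Rightarrow> 'x) \<Rightarrow> 'x measure \<Rightarrow> 'x set measure" where
  "quotient_pushforward \<phi> P = distr P (quotient_borel \<phi>) (group_orbit \<phi>)"

definition positive_definite_kernel :: "('x \<Rightarrow> 'x \<Rightarrow> real) \<Rightarrow> bool" where
  "positive_definite_kernel k \<longleftrightarrow>
     (\<forall>x y. k x y = k y x) \<and>
     (\<forall>(n::nat) (a :: nat \<Rightarrow> real) (x :: nat \<Rightarrow> 'x).
        (\<Sum>i<n. \<Sum>j<n. a i * a j * k (x i) (x j)) \<ge> 0)"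

definition admissible_measures ::
    "('x \<Rightarrow> real) \<Rightarrow> ('g::topological_space \<Rightarrow> 'x \<Rightarrow> 'x) \<Rightarrow> 'g measure set" where
  "admissible_measures \<rho> \<phi> =
     {\<nu>. sets \<nu> = sets borel \<and> sigma_finite_measure \<nu> \<and>
          (SUP x. \<integral>\<^sup>+ g. ennreal (\<rho> (\<phi> g x)) \<partial>\<nu>) < \<infinity>}"

definition averaged_measure ::
    "('g \<Rightarrow> 'x::topological_space \<Rightarrow> 'x) \<Rightarrow> 'g measure \<Rightarrow> 'x measure \<Rightarrow> 'x measure" where
  "averaged_measure \<phi> \<nu> P =
     measure_of UNIV (sets borel) (\<lambda>A. \<integral>\<^sup>+ g. emeasure P (\<phi> g -` A) \<partial>\<nu>)"

lemma sets_averaged_measure: "sets (averaged_measure \<phi> \<nu> P) = sets borel"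
  unfolding averaged_measure_def
  by (metis sets.sets_measure_of_eq space_borel)

text \<open>
  \<^const>\<open>measure_of\<close> yields the null measure when it is not given a measure; the following shows that
  this case does not arise here.
\<close>

lemma emeasure_averaged_measure:
  fixes \<phi> :: "'g::topological_group_add \<Rightarrow> 'x::topological_space \<Rightarrow> 'x"
  assumes \<phi>: "measurable_action \<phi>"
    and \<nu>: "sets \<nu> = sets borel"
    and P: "prob_space P" "sets P = sets borel"
    and A: "A \<in> sets borel"
  shows "emeasure (averaged_measure \<phi> \<nu> P) A = (\<integral>\<^sup>+ g. emeasure P (\<phi> g -` A) \<partial>\<nu>)"
proof -
  interpret prob_space P by (rule P)
  let ?\<mu> = "\<lambda>A. \<integral>\<^sup>+ g. emeasure P (\<phi> g -` A) \<partial>\<nu>"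
  have sp: "space \<nu> = UNIV" "space P = UNIV"
    using sets_eq_imp_space_eq[OF \<nu>] sets_eq_imp_space_eq[OF P(2)] by auto
  have eq: "sets (\<nu> \<Otimes>\<^sub>M P) = sets (borel \<Otimes>\<^sub>M borel)"
    by (rule sets_pair_measure_cong[OF \<nu> P(2)])
  have m: "(\<lambda>(g, x). \<phi> g x) \<in> measurable (\<nu> \<Otimes>\<^sub>M P) borel"
    using \<phi> unfolding measurable_action_def measurable_cong_sets[OF eq refl] by blast
  have pre: "(\<lambda>(g, x). \<phi> g x) -` B \<in> sets (\<nu> \<Otimes>\<^sub>M P)" if "B \<in> sets borel" for B
    using measurable_sets[OF m that] by (simp add: space_pair_measure sp)
  have sec: "Pair g -` ((\<lambda>(g, x). \<phi> g x) -` B) = \<phi> g -` B" for g B by auto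
  have S: "\<phi> g -` B \<in> sets P" if "B \<in> sets borel" for g B
    using sets_Pair1[OF pre[OF that], of g] unfolding sec .
  have M: "(\<lambda>g. emeasure P (\<phi> g -` B)) \<in> borel_measurable \<nu>" if "B \<in> sets borel" for B
    using measurable_emeasure_Pair[OF pre[OF that]] unfolding sec .
  have sa: "sigma_algebra UNIV (sets (borel :: 'x measure))"
    by (metis sets.sigma_algebra_axioms space_borel)
  have "measure_space UNIV (sets borel) ?\<mu>"
    unfolding measure_space_def
  proof (intro conjI sa)
    show "positive (sets borel) ?\<mu>" by (simp add: positive_def)
    show "countably_additive (sets borel) ?\<mu>"
    proof (rule countably_additiveI)
      fix B :: "nat \<Rightarrow> 'x set"
      assume B: "range B \<subseteq> sets borel" "disjoint_family B"
      then have b: "B i \<in> sets borel" for i by auto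
      have "(\<Sum>i. ?\<mu> (B i)) = (\<integral>\<^sup>+ g. (\<Sum>i. emeasure P (\<phi> g -` B i)) \<partial>\<nu>)"
        by (rule nn_integral_suminf[symmetric]) (rule M[OF b])
      also have "\<dots> = (\<integral>\<^sup>+ g. emeasure P (\<Union>i. \<phi> g -` B i) \<partial>\<nu>)"
      proof (rule nn_integral_cong)
        fix g
        show "(\<Sum>i. emeasure P (\<phi> g -` B i)) = emeasure P (\<Union>i. \<phi> g -` B i)"
          using B(2) by (intro suminf_emeasure) (auto simp: S[OF b] disjoint_family_on_def)
      qed
      finally show "(\<Sum>i. ?\<mu> (B i)) = ?\<mu> (\<Union>i. B i)" by (simp add: vimage_UN)
    qed
  qed
  moreover have "sigma_sets UNIV (sets borel) = sets (borel :: 'x measure)"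
    by (rule sigma_algebra.sigma_sets_eq[OF sa])
  ultimately show ?thesis
    unfolding averaged_measure_def by (subst emeasure_measure_of_conv) (simp add: A)
qed

end

theory Submission
  imports Defs
begin

text \<open>
  The function \<open>F x = \<integral> \<rho> (\<phi> g x) d\<mu>(g)\<close> is strictly positive, bounded, and invariant
  by unimodularity. Hence \<open>w = \<rho> / F\<close> satisfies \<open>\<integral> w (\<phi> g x) d\<mu>(g) = 1\<close> for all \<open>x\<close>, and for
  invariant \<open>A\<close> the integral of \<open>w\<close> over \<open>A\<close> against the averaged measure of \<open>P\<close> is \<open>P A\<close>: the
  averaged measure determines \<open>P\<close> on invariant sets. Conversely, the averaged measure of \<open>A\<close> is the
  \<open>P\<close>-integral of the invariant function \<open>x \<mapsto> \<mu> {g. \<phi> g x \<in> A}\<close>.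
\<close>

lemma group_orbit_eq_iff:
  assumes "measurable_action \<phi>"
  shows "group_orbit \<phi> x = group_orbit \<phi> y \<longleftrightarrow> (\<exists>g. y = \<phi> g x)"
proof
  assume eq: "group_orbit \<phi> x = group_orbit \<phi> y"
  have "\<phi> 0 y \<in> group_orbit \<phi> y" unfolding group_orbit_def by blast
  then have "y \<in> group_orbit \<phi> x" using assms by (simp add: eq measurable_action_def)
  then show "\<exists>g. y = \<phi> g x" by (auto simp: group_orbit_def)
next
  assume "\<exists>g. y = \<phi> g x"
  then obtain g where y: "y = \<phi> g x" ..
  have add: "\<phi> (h + h') z = \<phi> h (\<phi> h' z)" for h h' z
    using assms by (simp add: measurable_action_def)
  have "\<phi> h x = \<phi> (h + - g) y" for h
    by (simp add: y add[symmetric] add.assoc)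
  moreover have "\<phi> h y = \<phi> (h + g) x" for h by (simp add: y add)
  ultimately show "group_orbit \<phi> x = group_orbit \<phi> y"
    unfolding group_orbit_def by blast
qed

lemma measurable_group_orbit: "group_orbit \<phi> \<in> measurable borel (quotient_borel \<phi>)"
  by (rule measurableI) (auto simp: space_quotient_borel sets_quotient_borel orbit_space_def)

text \<open>Invariant Borel functions are exactly the measurable functions on the orbit space
  composed with the orbit map. Both directions of the theorem can thus test invariant functions on
  the original space and never return to the quotient. The functions are
  \<open>ennreal\<close>-valued, so no integrability question arises.\<close>

lemma quotient_pushforward_eq_iff:
  fixes \<phi> :: "'g::topological_group_add \<Rightarrow> 'x::topological_space \<Rightarrow> 'x"
  assumes \<phi>: "measurable_action \<phi>"
    and P: "sets P = sets borel" and Q: "sets Q = sets borel"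
  shows "quotient_pushforward \<phi> P = quotient_pushforward \<phi> Q \<longleftrightarrow>
    (\<forall>f \<in> borel_measurable borel. (\<forall>g x. f (\<phi> g x) = f x) \<longrightarrow>
      (\<integral>\<^sup>+ x. f x \<partial>P) = (\<integral>\<^sup>+ x. f x \<partial>Q))"
    (is "?L \<longleftrightarrow> ?R")
proof
  have meas: "group_orbit \<phi> \<in> measurable M (quotient_borel \<phi>)" if "sets M = sets borel" for M
    using measurable_group_orbit by (simp add: measurable_cong_sets[OF that refl])
  {
    assume eq: ?L
    show ?R
    proof (intro ballI impI)
      fix f :: "'x \<Rightarrow> ennreal"
      assume f: "f \<in> borel_measurable borel" and inv: "\<forall>g x. f (\<phi> g x) = f x"
      \<comment> \<open>\<open>f'\<close> is the descent of \<open>f\<close> to orbits, evaluated at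
        a chosen representative; invariance makes the choice irrelevant. Its values at sets that are
        not orbits are arbitrary, but these lie outside the space of
        \<open>quotient_borel\<close>.\<close>
      define f' where "f' U = f (SOME x. group_orbit \<phi> x = U)" for U
      have f': "f' (group_orbit \<phi> x) = f x" for x
      proof -
        have "group_orbit \<phi> (SOME y. group_orbit \<phi> y = group_orbit \<phi> x) = group_orbit \<phi> x"
          by (rule someI) (rule refl)
        then show ?thesis
          unfolding f'_def group_orbit_eq_iff[OF \<phi>] using inv by metis
      qed
      have f'_meas: "f' \<in> borel_measurable (quotient_borel \<phi>)"
      proof (rule measurableI)
        fix S :: "ennreal set" assume "S \<in> sets borel"
        then have "f -` S \<in> sets borel" using measurable_sets[OF f] by simp
        moreover have "group_orbit \<phi> -` (f' -` S \<inter> orbit_space \<phi>) = f -` S"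
          by (auto simp: f' orbit_space_def)
        ultimately show "f' -` S \<inter> space (quotient_borel \<phi>) \<in> sets (quotient_borel \<phi>)"
          by (simp add: space_quotient_borel sets_quotient_borel)
      qed simp
      have "(\<integral>\<^sup>+ x. f x \<partial>M) = (\<integral>\<^sup>+ U. f' U \<partial>quotient_pushforward \<phi> M)"
        if "sets M = sets borel" for M
        unfolding quotient_pushforward_def
        using f'_meas by (subst nn_integral_distr[OF meas[OF that]]) (simp_all add: f')
      then show "(\<integral>\<^sup>+ x. f x \<partial>P) = (\<integral>\<^sup>+ x. f x \<partial>Q)"
        using eq P Q by simp
    qed
  }
  assume eq: ?R
  show ?L
  proof (rule measure_eqI)
    fix A assume "A \<in> sets (quotient_pushforward \<phi> P)"
    then have A: "A \<in> sets (quotient_borel \<phi>)" by (simp add: quotient_pushforward_def)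
    let ?B = "group_orbit \<phi> -` A"
    have B: "?B \<in> sets borel" using A by (simp add: sets_quotient_borel)
    \<comment> \<open>The preimage \<open>?B\<close> is a union of orbits, so its indicator is an
      admissible invariant test function.\<close>
    have "group_orbit \<phi> (\<phi> g x) = group_orbit \<phi> x" for g x
      by (metis group_orbit_eq_iff[OF \<phi>])
    then have "\<forall>g x. indicator ?B (\<phi> g x) = (indicator ?B x :: ennreal)"
      by (simp add: indicator_def)
    then have "(\<integral>\<^sup>+ x. indicator ?B x \<partial>P) = (\<integral>\<^sup>+ x. indicator ?B x \<partial>Q)"
      using eq B by simp
    then have "emeasure P ?B = emeasure Q ?B"
      using B P Q by simp
    then show "emeasure (quotient_pushforward \<phi> P) A = emeasure (quotient_pushforward \<phi> Q) A"
      using sets_eq_imp_space_eq[OF P] sets_eq_imp_space_eq[OF Q]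
      by (simp add: quotient_pushforward_def emeasure_distr meas P Q A)
  qed (simp add: quotient_pushforward_def)
qed

lemma measurable_action_pair:
  fixes \<phi> :: "'g::topological_group_add \<Rightarrow> 'x::topological_space \<Rightarrow> 'x"
  assumes "measurable_action \<phi>" and "sets \<nu> = sets borel" and "sets P = sets borel"
  shows "(\<lambda>(g, x). \<phi> g x) \<in> measurable (\<nu> \<Otimes>\<^sub>M P) borel"
  using assms(1) unfolding measurable_action_def
    measurable_cong_sets[OF sets_pair_measure_cong[OF assms(2,3)] refl] by blast

lemma averaged_measure_eq_distr:
  fixes \<phi> :: "'g::topological_group_add \<Rightarrow> 'x::topological_space \<Rightarrow> 'x"
  assumes \<phi>: "measurable_action \<phi>" and \<nu>: "sets \<nu> = sets borel"
    and P: "prob_space P" "sets P = sets borel"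
  shows "averaged_measure \<phi> \<nu> P = distr (\<nu> \<Otimes>\<^sub>M P) borel (\<lambda>(g, x). \<phi> g x)"
proof (rule measure_eqI)
  interpret prob_space P by (rule P)
  fix A assume "A \<in> sets (averaged_measure \<phi> \<nu> P)"
  then have A: "A \<in> sets borel" by (simp add: sets_averaged_measure)
  note m = measurable_action_pair[OF \<phi> \<nu> P(2)]
  have sp: "space (\<nu> \<Otimes>\<^sub>M P) = UNIV"
    using sets_eq_imp_space_eq[OF \<nu>] sets_eq_imp_space_eq[OF P(2)]
    by (simp add: space_pair_measure)
  have "emeasure (distr (\<nu> \<Otimes>\<^sub>M P) borel (\<lambda>(g, x). \<phi> g x)) A =
      emeasure (\<nu> \<Otimes>\<^sub>M P) ((\<lambda>(g, x). \<phi> g x) -` A)"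
    using m A by (simp add: emeasure_distr sp)
  also have "\<dots> = (\<integral>\<^sup>+ g. emeasure P (Pair g -` (\<lambda>(g, x). \<phi> g x) -` A) \<partial>\<nu>)"
    using measurable_sets[OF m A] by (intro emeasure_pair_measure_alt) (simp add: sp)
  also have "\<dots> = (\<integral>\<^sup>+ g. emeasure P (\<phi> g -` A) \<partial>\<nu>)"
    by (simp add: vimage_def)
  finally show "emeasure (averaged_measure \<phi> \<nu> P) A =
      emeasure (distr (\<nu> \<Otimes>\<^sub>M P) borel (\<lambda>(g, x). \<phi> g x)) A"
    by (simp add: emeasure_averaged_measure[OF \<phi> \<nu> P A])
qed (simp add: sets_averaged_measure)

lemma borel_measurable_orbit_integral:
  fixes \<phi> :: "'g::topological_group_add \<Rightarrow> 'x::topological_space \<Rightarrow> 'x"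
    and f :: "'x \<Rightarrow> ennreal"
  assumes \<phi>: "measurable_action \<phi>" and \<nu>: "sets \<nu> = sets borel" "sigma_finite_measure \<nu>"
    and f: "f \<in> borel_measurable borel"
  shows "(\<lambda>x. \<integral>\<^sup>+ g. f (\<phi> g x) \<partial>\<nu>) \<in> borel_measurable borel"
proof -
  interpret sigma_finite_measure \<nu> by (rule \<nu>)
  \<comment> \<open>The group variable is to be integrated out, and
    \<open>borel_measurable_nn_integral\<close> integrates the second coordinate; hence the swap of
    the pair.\<close>
  have "(\<lambda>(x, g). f (\<phi> g x)) \<in> borel_measurable (borel \<Otimes>\<^sub>M \<nu>)"
    using measurable_compose[OF measurable_pair_swap'
        measurable_compose[OF measurable_action_pair[OF \<phi> \<nu>(1) refl] f]]
    by (simp add: case_prod_unfold)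
  then show ?thesis by (rule borel_measurable_nn_integral)
qed

text \<open>Tonelli with the group integral inside: integrating \<open>f\<close> against the
  averaged measure amounts to integrating its orbit integral against \<open>P\<close>.\<close>

lemma nn_integral_averaged_measure:
  fixes \<phi> :: "'g::topological_group_add \<Rightarrow> 'x::topological_space \<Rightarrow> 'x"
    and f :: "'x \<Rightarrow> ennreal"
  assumes \<phi>: "measurable_action \<phi>" and \<nu>: "sets \<nu> = sets borel" "sigma_finite_measure \<nu>"
    and P: "prob_space P" "sets P = sets borel"
    and f: "f \<in> borel_measurable borel"
  shows "(\<integral>\<^sup>+ y. f y \<partial>averaged_measure \<phi> \<nu> P) = (\<integral>\<^sup>+ x. \<integral>\<^sup>+ g. f (\<phi> g x) \<partial>\<nu> \<partial>P)"
proof -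
  interpret \<nu>: sigma_finite_measure \<nu> by (rule \<nu>)
  interpret P: prob_space P by (rule P)
  interpret pair_sigma_finite \<nu> P ..
  note m = measurable_action_pair[OF \<phi> \<nu>(1) P(2)]
  have "(\<integral>\<^sup>+ y. f y \<partial>averaged_measure \<phi> \<nu> P) = (\<integral>\<^sup>+ (g, x). f (\<phi> g x) \<partial>(\<nu> \<Otimes>\<^sub>M P))"
    unfolding averaged_measure_eq_distr[OF \<phi> \<nu>(1) P]
    using f by (subst nn_integral_distr[OF m]) (simp_all add: case_prod_unfold)
  also have "\<dots> = (\<integral>\<^sup>+ x. \<integral>\<^sup>+ g. f (\<phi> g x) \<partial>\<nu> \<partial>P)"
    using nn_integral_snd[of "\<lambda>(g, x). f (\<phi> g x)"] measurable_compose[OF m f]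
    by (simp add: case_prod_unfold)
  finally show ?thesis .
qed

text \<open>Since \<phi> is a left action, \<open>\<phi> g (\<phi> h x) = \<phi> (g + h) x\<close>:
  moving the base point along its orbit is a right translation of the group variable. This is why
  right invariance is required, which for a Haar measure comes from unimodularity.\<close>

lemma orbit_integral_invariant:
  fixes \<phi> :: "'g::topological_group_add \<Rightarrow> 'x::topological_space \<Rightarrow> 'x"
    and f :: "'x \<Rightarrow> ennreal"
  assumes \<phi>: "measurable_action \<phi>" and \<nu>: "sets \<nu> = sets borel" "right_invariant \<nu>"
    and f: "f \<in> borel_measurable borel"
  shows "(\<integral>\<^sup>+ g. f (\<phi> g (\<phi> h x)) \<partial>\<nu>) = (\<integral>\<^sup>+ g. f (\<phi> g x) \<partial>\<nu>)"
proof -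
  have "(\<lambda>g. g + h) \<in> borel_measurable borel"
    by (intro borel_measurable_continuous_onI continuous_intros)
  then have shift: "(\<lambda>g. g + h) \<in> measurable \<nu> borel"
    by (simp add: measurable_cong_sets[OF \<nu>(1) refl])
  have m: "(\<lambda>g. f (\<phi> g x)) \<in> borel_measurable borel"
    using measurable_compose[OF measurable_Pair2'
        measurable_compose[OF measurable_action_pair[OF \<phi> refl refl] f]]
    by simp
  have "(\<integral>\<^sup>+ g. f (\<phi> g x) \<partial>\<nu>) = (\<integral>\<^sup>+ g. f (\<phi> g x) \<partial>distr \<nu> borel (\<lambda>g. g + h))"
    using \<nu>(2) by (simp add: right_invariant_def)
  also have "\<dots> = (\<integral>\<^sup>+ g. f (\<phi> (g + h) x) \<partial>\<nu>)"
    using m by (intro nn_integral_distr[OF shift]) simp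
  finally show ?thesis
    using \<phi> by (simp add: measurable_action_def)
qed

theorem theorem1:
  fixes \<mu> :: "'g::{topological_group_add, t2_space} measure"
    and \<phi> :: "'g \<Rightarrow> 'x::polish_space \<Rightarrow> 'x"
    and k :: "'x \<Rightarrow> 'x \<Rightarrow> real"
    and \<rho> :: "'x \<Rightarrow> real"
    and P Q :: "'x measure"
  assumes "locally_compact_space (euclidean :: 'g topology)"
    and "sigma_compact_space (euclidean :: 'g topology)"
    and "unimodular TYPE('g)"
    and "haar_measure \<mu>"
    and "measurable_action \<phi>"
    and "positive_definite_kernel k"
    and "continuous_on UNIV (\<lambda>(x, y). k x y)"
    and "bounded (range (\<lambda>(x, y). k x y))"
    and "\<And>x. \<rho> x > 0"
    and "continuous_on UNIV \<rho>"
    and "bounded (range \<rho>)"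
    and "\<mu> \<in> admissible_measures \<rho> \<phi>"
    and "prob_space P" and "sets P = sets borel"
    and "prob_space Q" and "sets Q = sets borel"
  shows "averaged_measure \<phi> \<mu> P = averaged_measure \<phi> \<mu> Q \<longleftrightarrow>
         quotient_pushforward \<phi> P = quotient_pushforward \<phi> Q"
proof -
  note \<phi> = assms(5) and P = assms(13,14) and Q = assms(15,16)
  have \<mu>: "sets \<mu> = sets borel" "sigma_finite_measure \<mu>"
    and fin: "(SUP x. \<integral>\<^sup>+ g. ennreal (\<rho> (\<phi> g x)) \<partial>\<mu>) < \<infinity>"
    using assms(12) by (auto simp: admissible_measures_def)
  have inv: "right_invariant \<mu>" using assms(3,4) by (simp add: unimodular_def)
  have nz: "emeasure \<mu> (space \<mu>) \<noteq> 0"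
    using assms(4) sets_eq_imp_space_eq[OF \<mu>(1)] by (simp add: haar_measure_def)
  have \<rho>: "(\<lambda>x. ennreal (\<rho> x)) \<in> borel_measurable borel"
    using borel_measurable_continuous_onI[OF assms(10)] by simp
  define F where "F x = (\<integral>\<^sup>+ g. ennreal (\<rho> (\<phi> g x)) \<partial>\<mu>)" for x
  have F_meas: "F \<in> borel_measurable borel"
    unfolding F_def by (rule borel_measurable_orbit_integral[OF \<phi> \<mu> \<rho>])
  have F_inv: "F (\<phi> g x) = F x" for g x
    unfolding F_def by (rule orbit_integral_invariant[OF \<phi> \<mu>(1) inv \<rho>])
  have orbit_meas: "(\<lambda>g. f (\<phi> g x)) \<in> borel_measurable \<mu>"
    if "f \<in> borel_measurable borel" for f :: "'x \<Rightarrow> ennreal" and x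
    using measurable_compose[OF measurable_Pair2'
        measurable_compose[OF measurable_action_pair[OF \<phi> \<mu>(1) refl] that]]
    by simp
  have F_top: "F x \<noteq> \<top>" for x
  proof -
    have "F x \<le> (SUP x. \<integral>\<^sup>+ g. ennreal (\<rho> (\<phi> g x)) \<partial>\<mu>)"
      unfolding F_def by (rule SUP_upper) simp
    also note fin
    finally show ?thesis by simp
  qed
  \<comment> \<open>If F vanished at x, the strictly positive function \<rho> would be zero at
    almost every \<open>\<phi> g x\<close>, which forces \<mu> to be null.\<close>
  have F_pos: "F x \<noteq> 0" for x
  proof
    assume "F x = 0"
    then have "AE g in \<mu>. ennreal (\<rho> (\<phi> g x)) = 0"
      unfolding F_def using nn_integral_0_iff_AE[OF orbit_meas[OF \<rho>]] by simp
    then have "AE g in \<mu>. False"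
      using assms(9) by (auto simp: ennreal_eq_0_iff not_le)
    with nz show False by (simp add: AE_iff_null null_sets_def)
  qed
  show ?thesis
  proof
    assume eq: "averaged_measure \<phi> \<mu> P = averaged_measure \<phi> \<mu> Q"
    show "quotient_pushforward \<phi> P = quotient_pushforward \<phi> Q"
      unfolding quotient_pushforward_eq_iff[OF \<phi> P(2) Q(2)]
    proof (intro ballI impI)
      fix f :: "'x \<Rightarrow> ennreal"
      assume f: "f \<in> borel_measurable borel" and f_inv: "\<forall>g x. f (\<phi> g x) = f x"
      \<comment> \<open>An invariant \<open>f\<close> is recovered from its weighted version:
        \<open>f / F\<close> is constant along orbits, so it leaves the group integral, and what
        remains of \<rho> integrates to F.\<close>
      have w: "(\<lambda>x. f x / F x * ennreal (\<rho> x)) \<in> borel_measurable borel"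
        using f F_meas \<rho> by measurable
      have "(\<integral>\<^sup>+ g. f (\<phi> g x) / F (\<phi> g x) * ennreal (\<rho> (\<phi> g x)) \<partial>\<mu>) = f x" for x
      proof -
        have "(\<integral>\<^sup>+ g. f (\<phi> g x) / F (\<phi> g x) * ennreal (\<rho> (\<phi> g x)) \<partial>\<mu>) = f x / F x * F x"
          unfolding F_inv f_inv[rule_format]
          by (subst nn_integral_cmult[OF orbit_meas[OF \<rho>]]) (simp add: F_def)
        \<comment> \<open>Cancelling in \<open>ennreal\<close> requires that F x be neither zero nor
          infinite; \<open>f x\<close> itself may be infinite.\<close>
        also have "\<dots> = f x"
          by (simp add: ennreal_divide_times ennreal_divide_self F_pos F_top less_top[symmetric])
        finally show ?thesis .
      qed
      \<comment> \<open>The left side sees \<open>M\<close> only through its averaged measure, so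
        equal averaged measures give equal integrals of \<open>f\<close>.\<close>
      then have "(\<integral>\<^sup>+ y. f y / F y * ennreal (\<rho> y) \<partial>averaged_measure \<phi> \<mu> M) = (\<integral>\<^sup>+ x. f x \<partial>M)"
        if "prob_space M" "sets M = sets borel" for M
        using nn_integral_averaged_measure[OF \<phi> \<mu> that w] by simp
      then show "(\<integral>\<^sup>+ x. f x \<partial>P) = (\<integral>\<^sup>+ x. f x \<partial>Q)"
        using P Q eq by metis
    qed
  next
    assume eq: "quotient_pushforward \<phi> P = quotient_pushforward \<phi> Q"
    show "averaged_measure \<phi> \<mu> P = averaged_measure \<phi> \<mu> Q"
    proof (rule measure_eqI)
      fix A assume "A \<in> sets (averaged_measure \<phi> \<mu> P)"
      then have A: "A \<in> sets borel" by (simp add: sets_averaged_measure)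
      then have ind: "indicator A \<in> borel_measurable (borel :: 'x measure)" by simp
      \<comment> \<open>The inner integral is the Haar measure of the group elements that send x
        into A. As a function of x it is Borel and invariant, hence a test function for the
        quotient; the value \<infinity> is allowed.\<close>
      have emeasure_eq: "emeasure (averaged_measure \<phi> \<mu> M) A =
          (\<integral>\<^sup>+ x. \<integral>\<^sup>+ g. indicator A (\<phi> g x) \<partial>\<mu> \<partial>M)"
        if "prob_space M" "sets M = sets borel" for M
        using nn_integral_averaged_measure[OF \<phi> \<mu> that ind] A
        by (simp add: sets_averaged_measure)
      show "emeasure (averaged_measure \<phi> \<mu> P) A = emeasure (averaged_measure \<phi> \<mu> Q) A"
        unfolding emeasure_eq[OF P] emeasure_eq[OF Q]
        using eq borel_measurable_orbit_integral[OF \<phi> \<mu> ind]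
        by (auto simp: quotient_pushforward_eq_iff[OF \<phi> P(2) Q(2)]
            orbit_integral_invariant[OF \<phi> \<mu>(1) inv ind])
    qed (simp add: sets_averaged_measure)
  qed
qed

end
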